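(* Let $G$ be a group with identity $e$, let $n$ be a positive integer, and let $R=(M_{ij})_{i,j\in\mathbb{I}_n}$ be an $n$-by-$n$ generalized matrix ring such that each $R_i=M_{ii}$ is a unital ring. Let $\mathcal{D}=\big(\{\alpha^{(i)}\}_{i\in\mathbb{I}_n},\{\gamma_g\}_{g\in G}\big)$ be a datum for $R$, where $\alpha^{(i)}=(D^{(i)}_g,\alpha^{(i)}_g)_{g\in G}$ is a partial action of $G$ on $R_i$ and $\gamma_g=\{\gamma^{(ij)}_g:D^{(i)}_{g^{-1}}M_{ij}\to D^{(i)}_gM_{ij}\}_{i,j\in\mathbb{I}_n}$. For $g\in G$ let $I_g=\big(D^{(i)}_gM_{ij}\big)_{i,j\in\mathbb{I}_n}$, which is an ideal of $R$, and denote also by $\gamma_g:I_{g^{-1}}\to I_g$ the additive bijection $\gamma_g\big((a_{ij})_{i,j}\big)=\big(\gamma^{(ij)}_g(a_{ij})\big)_{i,j}$. Then the family $\gamma=(I_g,\gamma_g)_{g\in G}$ is a partial action of the group $G$ on the generalized matrix ring $R$.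
   Context: Rings are associative; modules over unital rings are unital. $\mathbb{I}_n=\{1,\dots,n\}$. An $n$-by-$n$ generalized matrix ring $R=(M_{ij})_{i,j\in\mathbb{I}_n}$ is given by rings $R_1,\dots,R_n$, $(R_i,R_j)$-bimodules $M_{ij}$ with $M_{ii}=R_i$, and bimodule morphisms $\theta_{ijk}:M_{ij}\otimes_{R_j}M_{jk}\to M_{ik}$; one writes $m_{ij}m_{jk}:=\theta_{ijk}(m_{ij}\otimes m_{jk})$ and requires $(m_{ij}m_{jk})m_{kl}=m_{ij}(m_{jk}m_{kl})$ for all indices. Here $\theta_{iii}$ is the multiplication of $R_i$, and $\theta_{ijj},\theta_{jjk}$ are given by the bimodule structures. Elements of $R$ are arrays $(m_{ij})$, $m_{ij}\in M_{ij}$, with componentwise addition and row-column multiplication. Products such as $D M$ denote the additive subgroup generated by all products. A partial action of a group $G$ on a ring $A$ is a family $\alpha=(A_g,\alpha_g)_{g\in G}$ where each $A_g$ is an ideal of $A$ and $\alpha_g:A_{g^{-1}}\to A_g$ is a ring isomorphism, such that (i) $A_e=A$, $\alpha_e=\mathrm{id}_A$; (ii) $\alpha_{h^{-1}}(A_h\cap A_{g^{-1}})\subset A_{(gh)^{-1}}$ for all $g,h\in G$; (iii) $\alpha_g(\alpha_h(a))=\alpha_{gh}(a)$ for all $a\in\alpha_h^{-1}(A_h\cap A_{g^{-1}})$. Datum: $\mathcal{D}=\big(\{\alpha^{(i)}\}_{i\in\mathbb{I}_n},\{\gamma_g\}_{g\in G}\big)$, with $\alpha^{(i)}=(D^{(i)}_g,\alpha^{(i)}_g)_{g\in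 G}$ a partial action of $G$ on $R_i$ and $\gamma_g=\{\gamma^{(ij)}_g:D^{(i)}_{g^{-1}}M_{ij}\to D^{(i)}_gM_{ij}\}_{i,j\in\mathbb{I}_n}$ a set of additive bijections, is a datum for $R$ if: (a) $D^{(i)}_gM_{ij}=M_{ij}D^{(j)}_g$ for all $g\in G$, $i,j\in\mathbb{I}_n$; (b) for all $g,h\in G$ and $i,j,k\in\mathbb{I}_n$: $\gamma^{(ii)}_g=\alpha^{(i)}_g$ and $\gamma^{(ij)}_e=\mathrm{id}_{M_{ij}}$; $\gamma^{(ik)}_g(u)\gamma^{(kj)}_g(v)=\gamma^{(ij)}_g(uv)$ for all $u\in D^{(i)}_{g^{-1}}M_{ik}$, $v\in D^{(k)}_{g^{-1}}M_{kj}$; $(\gamma^{(ij)}_h)^{-1}\big(D^{(i)}_{g^{-1}}M_{ij}\cap D^{(i)}_hM_{ij}\big)\subset D^{(i)}_{(gh)^{-1}}M_{ij}$; and $\gamma^{(ij)}_g(\gamma^{(ij)}_h(a))=\gamma^{(ij)}_{gh}(a)$ for all $a\in(\gamma^{(ij)}_h)^{-1}\big(D^{(i)}_{g^{-1}}M_{ij}\cap D^{(i)}_hM_{ij}\big)$. *)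

theory Defs
  imports "HOL-Algebra.Algebra"
begin

section \<open>Bimodules\<close>

text \<open>As for the library's \<open>module\<close>, the record extends \<open>ring\<close>, but the fields \<open>mult\<close> and \<open>one\<close>
  of a bimodule are irrelevant in general. They matter only for the diagonal entries
  \<open>M i i\<close> of a generalized matrix ring, which are rings themselves.\<close>

record ('r, 's, 'm) bimodule = "'m ring" +
  lsmult :: "'r \<Rightarrow> 'm \<Rightarrow> 'm"
  rsmult :: "'m \<Rightarrow> 's \<Rightarrow> 'm"

locale bimodule = R: ring R + S: ring S + M: abelian_group M
  for R :: "('r, 'a) ring_scheme" and S :: "('s, 'b) ring_scheme"
    and M :: "('r, 's, 'm, 'c) bimodule_scheme" +
  assumes lsmult_closed:
      "\<lbrakk>r \<in> carrier R; x \<in> carrier M\<rbrakk> \<Longrightarrow> lsmult M r x \<in> carrier M"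
    and lsmult_l_distr:
      "\<lbrakk>r \<in> carrier R; r' \<in> carrier R; x \<in> carrier M\<rbrakk>
        \<Longrightarrow> lsmult M (r \<oplus>\<^bsub>R\<^esub> r') x = lsmult M r x \<oplus>\<^bsub>M\<^esub> lsmult M r' x"
    and lsmult_r_distr:
      "\<lbrakk>r \<in> carrier R; x \<in> carrier M; y \<in> carrier M\<rbrakk>
        \<Longrightarrow> lsmult M r (x \<oplus>\<^bsub>M\<^esub> y) = lsmult M r x \<oplus>\<^bsub>M\<^esub> lsmult M r y"
    and lsmult_assoc:
      "\<lbrakk>r \<in> carrier R; r' \<in> carrier R; x \<in> carrier M\<rbrakk>
        \<Longrightarrow> lsmult M (r \<otimes>\<^bsub>R\<^esub> r') x = lsmult M r (lsmult M r' x)"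
    and lsmult_one:
      "x \<in> carrier M \<Longrightarrow> lsmult M \<one>\<^bsub>R\<^esub> x = x"
    and rsmult_closed:
      "\<lbrakk>x \<in> carrier M; s \<in> carrier S\<rbrakk> \<Longrightarrow> rsmult M x s \<in> carrier M"
    and rsmult_r_distr:
      "\<lbrakk>x \<in> carrier M; s \<in> carrier S; s' \<in> carrier S\<rbrakk>
        \<Longrightarrow> rsmult M x (s \<oplus>\<^bsub>S\<^esub> s') = rsmult M x s \<oplus>\<^bsub>M\<^esub> rsmult M x s'"
    and rsmult_l_distr:
      "\<lbrakk>x \<in> carrier M; y \<in> carrier M; s \<in> carrier S\<rbrakk>
        \<Longrightarrow> rsmult M (x \<oplus>\<^bsub>M\<^esub> y) s = rsmult M x s \<oplus>\<^bsub>M\<^esub> rsmult M y s"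
    and rsmult_assoc:
      "\<lbrakk>x \<in> carrier M; s \<in> carrier S; s' \<in> carrier S\<rbrakk>
        \<Longrightarrow> rsmult M x (s \<otimes>\<^bsub>S\<^esub> s') = rsmult M (rsmult M x s) s'"
    and rsmult_one:
      "x \<in> carrier M \<Longrightarrow> rsmult M x \<one>\<^bsub>S\<^esub> = x"
    and lsmult_rsmult:
      "\<lbrakk>r \<in> carrier R; x \<in> carrier M; s \<in> carrier S\<rbrakk>
        \<Longrightarrow> rsmult M (lsmult M r x) s = lsmult M r (rsmult M x s)"

definition bimodule_hom ::
  "('r, 'a) ring_scheme \<Rightarrow> ('s, 'b) ring_scheme \<Rightarrow> ('r, 's, 'm, 'c) bimodule_scheme
    \<Rightarrow> ('r, 's, 'n, 'd) bimodule_scheme \<Rightarrow> ('m \<Rightarrow> 'n) set"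
where
  "bimodule_hom R S M N =
    {f \<in> hom (add_monoid M) (add_monoid N).
       (\<forall>r\<in>carrier R. \<forall>x\<in>carrier M. f (lsmult M r x) = lsmult N r (f x)) \<and>
       (\<forall>x\<in>carrier M. \<forall>s\<in>carrier S. f (rsmult M x s) = rsmult N (f x) s)}"


section \<open>The tensor product of bimodules over a possibly noncommutative ring\<close>

definition tensor_relations ::
  "('s, 'a) ring_scheme \<Rightarrow> ('r, 's, 'm, 'b) bimodule_scheme
    \<Rightarrow> ('s, 't, 'n, 'c) bimodule_scheme \<Rightarrow> ('m \<times> 'n \<Rightarrow>\<^sub>0 int) set"
where
  "tensor_relations S M N =
     {frag_of (x \<oplus>\<^bsub>M\<^esub> x', y) - frag_of (x, y) - frag_of (x', y) | x x' y.
        x \<in> carrier M \<and> x' \<in> carrier M \<and> y \<in> carrier N} \<union>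
     {frag_of (x, y \<oplus>\<^bsub>N\<^esub> y') - frag_of (x, y) - frag_of (x, y') | x y y'.
        x \<in> carrier M \<and> y \<in> carrier N \<and> y' \<in> carrier N} \<union>
     {frag_of (rsmult M x s, y) - frag_of (x, lsmult N s y) | x s y.
        x \<in> carrier M \<and> s \<in> carrier S \<and> y \<in> carrier N}"

definition tensor_kernel ::
  "('s, 'a) ring_scheme \<Rightarrow> ('r, 's, 'm, 'b) bimodule_scheme
    \<Rightarrow> ('s, 't, 'n, 'c) bimodule_scheme \<Rightarrow> ('m \<times> 'n \<Rightarrow>\<^sub>0 int) set"
where
  "tensor_kernel S M N =
     generate (free_Abelian_group (carrier M \<times> carrier N)) (tensor_relations S M N)"

text \<open>The free abelian group on \<open>M \<times> N\<close> modulo the tensor relations. Its elements are cosets of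
  \<open>tensor_kernel\<close>, and a scalar acts on a coset by acting on its members. The image of a
  coset is in general only contained in a coset, hence the product with the kernel.\<close>

definition tensor_product ::
  "('s, 'a) ring_scheme \<Rightarrow> ('r, 's, 'm, 'b) bimodule_scheme
    \<Rightarrow> ('s, 't, 'n, 'c) bimodule_scheme \<Rightarrow> ('r, 't, ('m \<times> 'n \<Rightarrow>\<^sub>0 int) set) bimodule"
where
  "tensor_product S M N =
     (let F = free_Abelian_group (carrier M \<times> carrier N); K = tensor_kernel S M N
      in \<lparr>carrier = carrier (F Mod K), monoid.mult = undefined, one = undefined,
          ring.zero = \<one>\<^bsub>F Mod K\<^esub>, ring.add = monoid.mult (F Mod K),
          lsmult = (\<lambda>r T. K <#>\<^bsub>F\<^esub> frag_extend (\<lambda>(x, y). frag_of (lsmult M r x, y)) ` T),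
          rsmult = (\<lambda>T t. K <#>\<^bsub>F\<^esub> frag_extend (\<lambda>(x, y). frag_of (x, rsmult N y t)) ` T)\<rparr>)"

definition tensor ::
  "('s, 'a) ring_scheme \<Rightarrow> ('r, 's, 'm, 'b) bimodule_scheme
    \<Rightarrow> ('s, 't, 'n, 'c) bimodule_scheme \<Rightarrow> 'm \<Rightarrow> 'n \<Rightarrow> ('m \<times> 'n \<Rightarrow>\<^sub>0 int) set"
where
  "tensor S M N x y =
     tensor_kernel S M N #>\<^bsub>free_Abelian_group (carrier M \<times> carrier N)\<^esub> frag_of (x, y)"


section \<open>Generalized matrix rings\<close>

text \<open>The entries \<open>M i j\<close> share an element type, but have independent carriers and operations;
  only indices in \<open>{1..n}\<close> are relevant. The ring \<open>R\<^sub>i\<close> is \<open>M i i\<close>. The map \<open>\<theta> i j k\<close>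
  is defined on the tensor product of \<open>M i j\<close> and \<open>M j k\<close> over \<open>R\<^sub>j\<close>.\<close>

type_synonym 'a gm_entries = "nat \<Rightarrow> nat \<Rightarrow> ('a, 'a, 'a) bimodule"
type_synonym 'a gm_maps = "nat \<Rightarrow> nat \<Rightarrow> nat \<Rightarrow> ('a \<times> 'a \<Rightarrow>\<^sub>0 int) set \<Rightarrow> 'a"

definition gm_prod ::
  "'a gm_entries \<Rightarrow> 'a gm_maps \<Rightarrow> nat \<Rightarrow> nat \<Rightarrow> nat \<Rightarrow> 'a \<Rightarrow> 'a \<Rightarrow> 'a"
where
  "gm_prod M \<theta> i j k x y = \<theta> i j k (tensor (M j j) (M i j) (M j k) x y)"

text \<open>All rings are unital, as everywhere in \<open>HOL-Algebra\<close>. The conditions \<open>theta_right\<close> and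
  \<open>theta_left\<close> for equal indices, together with \<open>theta_diag\<close>, make both actions of \<open>R\<^sub>i\<close> on
  \<open>M i i\<close> the multiplication of \<open>R\<^sub>i\<close>.\<close>

locale generalized_matrix_ring =
  fixes n :: nat and M :: "'a gm_entries" and \<theta> :: "'a gm_maps"
  assumes ring_diag: "i \<in> {1..n} \<Longrightarrow> ring (M i i)"
    and bimodule_entry:
      "\<lbrakk>i \<in> {1..n}; j \<in> {1..n}\<rbrakk> \<Longrightarrow> bimodule (M i i) (M j j) (M i j)"
    and theta_hom:
      "\<lbrakk>i \<in> {1..n}; j \<in> {1..n}; k \<in> {1..n}\<rbrakk>
        \<Longrightarrow> \<theta> i j k \<in> bimodule_hom (M i i) (M k k) (tensor_product (M j j) (M i j) (M j k)) (M i k)"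
    and theta_diag:
      "\<lbrakk>i \<in> {1..n}; x \<in> carrier (M i i); y \<in> carrier (M i i)\<rbrakk>
        \<Longrightarrow> gm_prod M \<theta> i i i x y = x \<otimes>\<^bsub>M i i\<^esub> y"
    and theta_right:
      "\<lbrakk>i \<in> {1..n}; j \<in> {1..n}; x \<in> carrier (M i j); r \<in> carrier (M j j)\<rbrakk>
        \<Longrightarrow> gm_prod M \<theta> i j j x r = rsmult (M i j) x r"
    and theta_left:
      "\<lbrakk>j \<in> {1..n}; k \<in> {1..n}; r \<in> carrier (M j j); x \<in> carrier (M j k)\<rbrakk>
        \<Longrightarrow> gm_prod M \<theta> j j k r x = lsmult (M j k) r x"
    and theta_assoc:
      "\<lbrakk>i \<in> {1..n}; j \<in> {1..n}; k \<in> {1..n}; l \<in> {1..n};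
        x \<in> carrier (M i j); y \<in> carrier (M j k); z \<in> carrier (M k l)\<rbrakk>
        \<Longrightarrow> gm_prod M \<theta> i k l (gm_prod M \<theta> i j k x y) z
          = gm_prod M \<theta> i j l x (gm_prod M \<theta> j k l y z)"

definition gm_ring :: "nat \<Rightarrow> 'a gm_entries \<Rightarrow> 'a gm_maps \<Rightarrow> (nat \<times> nat \<Rightarrow> 'a) ring" where
  "gm_ring n M \<theta> =
     \<lparr>carrier = (\<Pi>\<^sub>E (i, j)\<in>{1..n} \<times> {1..n}. carrier (M i j)),
      monoid.mult = (\<lambda>a b. \<lambda>(i, j)\<in>{1..n} \<times> {1..n}.
        finsum (M i j) (\<lambda>k. gm_prod M \<theta> i k j (a (i, k)) (b (k, j))) {1..n}),
      one = (\<lambda>(i, j)\<in>{1..n} \<times> {1..n}. if i = j then \<one>\<^bsub>M i j\<^esub> else \<zero>\<^bsub>M i j\<^esub>),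
      ring.zero = (\<lambda>(i, j)\<in>{1..n} \<times> {1..n}. \<zero>\<^bsub>M i j\<^esub>),
      ring.add = (\<lambda>a b. \<lambda>(i, j)\<in>{1..n} \<times> {1..n}. a (i, j) \<oplus>\<^bsub>M i j\<^esub> b (i, j))\<rparr>"


section \<open>Partial actions\<close>

text \<open>Isomorphisms of rings that need not be unital, such as ideals; the library's \<open>ring_iso\<close>
  requires preservation of \<open>one\<close>.\<close>

definition rng_iso :: "('a, 'm) ring_scheme \<Rightarrow> ('b, 'n) ring_scheme \<Rightarrow> ('a \<Rightarrow> 'b) set" where
  "rng_iso A B = hom A B \<inter> iso (add_monoid A) (add_monoid B)"

locale partial_action = group G + A: ring A
  for G :: "('g, 'm) monoid_scheme" (structure) and A :: "('a, 'n) ring_scheme" +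
  fixes D :: "'g \<Rightarrow> 'a set" and \<alpha> :: "'g \<Rightarrow> 'a \<Rightarrow> 'a"
  assumes ideal_D: "g \<in> carrier G \<Longrightarrow> ideal (D g) A"
    and rng_iso_alpha:
      "g \<in> carrier G \<Longrightarrow> \<alpha> g \<in> rng_iso (A\<lparr>carrier := D (inv g)\<rparr>) (A\<lparr>carrier := D g\<rparr>)"
    and D_one: "D \<one> = carrier A"
    and alpha_one: "a \<in> carrier A \<Longrightarrow> \<alpha> \<one> a = a"
    and alpha_dom:
      "\<lbrakk>g \<in> carrier G; h \<in> carrier G\<rbrakk>
        \<Longrightarrow> \<alpha> (inv h) ` (D h \<inter> D (inv g)) \<subseteq> D (inv (g \<otimes> h))"
    and alpha_comp:
      "\<lbrakk>g \<in> carrier G; h \<in> carrier G; a \<in> D (inv h); \<alpha> h a \<in> D h \<inter> D (inv g)\<rbrakk>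
        \<Longrightarrow> \<alpha> g (\<alpha> h a) = \<alpha> (g \<otimes> h) a"


section \<open>Data for generalized matrix rings\<close>

text \<open>The products \<open>I M\<close> and \<open>M I\<close> are the additive subgroups generated by all products.\<close>

definition lprod :: "('r, 's, 'm, 'c) bimodule_scheme \<Rightarrow> 'r set \<Rightarrow> 'm set" where
  "lprod M I = generate (add_monoid M) {lsmult M r x | r x. r \<in> I \<and> x \<in> carrier M}"

definition rprod :: "('r, 's, 'm, 'c) bimodule_scheme \<Rightarrow> 's set \<Rightarrow> 'm set" where
  "rprod M I = generate (add_monoid M) {rsmult M x s | x s. x \<in> carrier M \<and> s \<in> I}"

text \<open>Here \<open>D i g\<close> is \<open>D\<^sup>(\<^sup>i\<^sup>)\<^sub>g\<close>, \<open>\<alpha> i g\<close> is \<open>\<alpha>\<^sup>(\<^sup>i\<^sup>)\<^sub>g\<close>, and \<open>\<gamma> g i j\<close> is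
  \<open>\<gamma>\<^sup>(\<^sup>i\<^sup>j\<^sup>)\<^sub>g\<close>, of which only the values on its domain \<open>lprod (M i j) (D i (inv g))\<close> matter.\<close>

locale gm_datum = group G + generalized_matrix_ring n M \<theta>
  for G :: "('g, 'm) monoid_scheme" (structure)
    and n :: nat and M :: "'a gm_entries" and \<theta> :: "'a gm_maps" +
  fixes D :: "nat \<Rightarrow> 'g \<Rightarrow> 'a set"
    and \<alpha> :: "nat \<Rightarrow> 'g \<Rightarrow> 'a \<Rightarrow> 'a"
    and \<gamma> :: "'g \<Rightarrow> nat \<Rightarrow> nat \<Rightarrow> 'a \<Rightarrow> 'a"
  assumes partial_action_diag: "i \<in> {1..n} \<Longrightarrow> partial_action G (M i i) (D i) (\<alpha> i)"
    and gamma_iso: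
      "\<lbrakk>g \<in> carrier G; i \<in> {1..n}; j \<in> {1..n}\<rbrakk>
        \<Longrightarrow> \<gamma> g i j \<in> iso (add_monoid ((M i j)\<lparr>carrier := lprod (M i j) (D i (inv g))\<rparr>))
                        (add_monoid ((M i j)\<lparr>carrier := lprod (M i j) (D i g)\<rparr>))"
    and lprod_eq_rprod:
      "\<lbrakk>g \<in> carrier G; i \<in> {1..n}; j \<in> {1..n}\<rbrakk>
        \<Longrightarrow> lprod (M i j) (D i g) = rprod (M i j) (D j g)"
    and gamma_diag:
      "\<lbrakk>g \<in> carrier G; i \<in> {1..n}; a \<in> lprod (M i i) (D i (inv g))\<rbrakk>
        \<Longrightarrow> \<gamma> g i i a = \<alpha> i g a"
    and gamma_one:
      "\<lbrakk>i \<in> {1..n}; j \<in> {1..n}; a \<in> carrier (M i j)\<rbrakk> \<Longrightarrow> \<gamma> \<one> i j a = a"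
    and gamma_mult:
      "\<lbrakk>g \<in> carrier G; i \<in> {1..n}; j \<in> {1..n}; k \<in> {1..n};
        u \<in> lprod (M i k) (D i (inv g)); v \<in> lprod (M k j) (D k (inv g))\<rbrakk>
        \<Longrightarrow> gm_prod M \<theta> i k j (\<gamma> g i k u) (\<gamma> g k j v) = \<gamma> g i j (gm_prod M \<theta> i k j u v)"
    and gamma_dom:
      "\<lbrakk>g \<in> carrier G; h \<in> carrier G; i \<in> {1..n}; j \<in> {1..n};
        a \<in> lprod (M i j) (D i (inv h));
        \<gamma> h i j a \<in> lprod (M i j) (D i (inv g)) \<inter> lprod (M i j) (D i h)\<rbrakk>
        \<Longrightarrow> a \<in> lprod (M i j) (D i (inv (g \<otimes> h)))"
    and gamma_comp:
      "\<lbrakk>g \<in> carrier G; h \<in> carrier G; i \<in> {1..n}; j \<in> {1..n};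
        a \<in> lprod (M i j) (D i (inv h));
        \<gamma> h i j a \<in> lprod (M i j) (D i (inv g)) \<inter> lprod (M i j) (D i h)\<rbrakk>
        \<Longrightarrow> \<gamma> g i j (\<gamma> h i j a) = \<gamma> (g \<otimes> h) i j a"

definition datum_ideal ::
  "nat \<Rightarrow> 'a gm_entries \<Rightarrow> (nat \<Rightarrow> 'g \<Rightarrow> 'a set) \<Rightarrow> 'g \<Rightarrow> (nat \<times> nat \<Rightarrow> 'a) set"
where
  "datum_ideal n M D g = (\<Pi>\<^sub>E (i, j)\<in>{1..n} \<times> {1..n}. lprod (M i j) (D i g))"

definition datum_map ::
  "nat \<Rightarrow> ('g \<Rightarrow> nat \<Rightarrow> nat \<Rightarrow> 'a \<Rightarrow> 'a) \<Rightarrow> 'g \<Rightarrow> (nat \<times> nat \<Rightarrow> 'a) \<Rightarrow> (nat \<times> nat \<Rightarrow> 'a)"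
where
  "datum_map n \<gamma> g a = (\<lambda>(i, j)\<in>{1..n} \<times> {1..n}. \<gamma> g i j (a (i, j)))"

end

theory Submission
  imports Defs
begin

text \<open>Everything is checked entry by entry. The axioms of a datum say that for fixed \<open>(i, j)\<close> the
  maps \<open>\<gamma> g i j\<close> form an additive partial action on \<open>M i j\<close>, whose domains are the subgroups
  \<open>D\<^sup>(\<^sup>i\<^sup>)\<^sub>g M i j\<close>. So the conditions on identity, domains and composition hold for matrices because
  they hold in each entry. Two points involve several entries at once.

  The subgroups \<open>I\<^sub>g\<close> are ideals. A matrix product with one factor in \<open>I\<^sub>g\<close> has entries that are sums
  of products \<open>x y\<close>. If \<open>x\<close> lies in \<open>D\<^sup>(\<^sup>i\<^sup>)\<^sub>g M i k\<close>, then \<open>x y\<close> lies in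
  \<open>D\<^sup>(\<^sup>i\<^sup>)\<^sub>g M i k M k j\<close>, hence in \<open>D\<^sup>(\<^sup>i\<^sup>)\<^sub>g M i j\<close> by associativity (\<open>E_mul_right\<close>). If instead \<open>y\<close> lies in
  \<open>D\<^sup>(\<^sup>k\<^sup>)\<^sub>g M k j\<close>, this subgroup is rewritten as \<open>M k j D\<^sup>(\<^sup>j\<^sup>)\<^sub>g\<close>, so that the ideal stands on the
  outer side again (\<open>E_mul_left\<close>).

  The maps are multiplicative. Since \<open>\<gamma> g i j\<close> is additive, it can be applied to each summand of an
  entry of a matrix product, and there it is compatible with products by the datum
  (\<open>datum_map_mult\<close>).

  That generalized matrices form a unital ring rests on the biadditivity of the products
  \<open>M i j \<times> M j k \<rightarrow> M i k\<close>. These are given by additive maps on tensor products, so the tensor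
  product itself has to be shown to be biadditive (\<open>tensor_addI\<close>).\<close>

section \<open>Finite sums in abelian groups\<close>

lemma (in abelian_group) finsum_in_subgroup:
  assumes "subgroup H (add_monoid G)" "finite A" "\<And>k. k \<in> A \<Longrightarrow> f k \<in> H"
  shows "finsum G f A \<in> H"
  using assms(2,3)
proof (induction A)
  case empty
  then show ?case using subgroup.one_closed[OF assms(1)] by simp
next
  case (insert k A)
  have sub: "H \<subseteq> carrier G" using subgroup.subset[OF assms(1)] by simp
  then have "finsum G f (insert k A) = f k \<oplus> finsum G f A"
    using insert by (intro finsum_insert) (auto simp: Pi_def)
  then show ?case using subgroup.m_closed[OF assms(1)] insert by simp
qed

text \<open>The map need only be additive on a subgroup \<open>H\<close>: the maps \<open>\<gamma> g i j\<close> are controlled only on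
  their domains.\<close>

lemma finsum_additive:
  assumes "abelian_group M" "abelian_group N" and H: "subgroup H (add_monoid M)"
    and closed: "\<And>x. x \<in> H \<Longrightarrow> \<phi> x \<in> carrier N"
    and add: "\<And>x y. \<lbrakk>x \<in> H; y \<in> H\<rbrakk> \<Longrightarrow> \<phi> (x \<oplus>\<^bsub>M\<^esub> y) = \<phi> x \<oplus>\<^bsub>N\<^esub> \<phi> y"
    and "finite A" "\<And>k. k \<in> A \<Longrightarrow> f k \<in> H"
  shows "\<phi> (finsum M f A) = finsum N (\<lambda>k. \<phi> (f k)) A"
proof -
  interpret M: abelian_group M by fact
  interpret N: abelian_group N by fact
  have sub: "H \<subseteq> carrier M" using subgroup.subset[OF H] by simp
  show ?thesis using assms(6,7)
  proof (induction A)
    case empty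
    have z: "\<zero>\<^bsub>M\<^esub> \<in> H" using subgroup.one_closed[OF H] by simp
    then have "\<phi> \<zero>\<^bsub>M\<^esub> = \<phi> \<zero>\<^bsub>M\<^esub> \<oplus>\<^bsub>N\<^esub> \<phi> \<zero>\<^bsub>M\<^esub>" using add[OF z z] by simp
    then have "\<phi> \<zero>\<^bsub>M\<^esub> = \<zero>\<^bsub>N\<^esub>" using closed[OF z] N.add.l_cancel_one' by simp
    then show ?case by simp
  next
    case (insert k A)
    then have s: "finsum M f A \<in> H" by (intro M.finsum_in_subgroup[OF H]) auto
    have "finsum M f (insert k A) = f k \<oplus>\<^bsub>M\<^esub> finsum M f A"
      using insert sub by (intro M.finsum_insert) (auto simp: Pi_def)
    moreover have "finsum N (\<lambda>k. \<phi> (f k)) (insert k A)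
        = \<phi> (f k) \<oplus>\<^bsub>N\<^esub> finsum N (\<lambda>k. \<phi> (f k)) A"
      using insert closed by (intro N.finsum_insert) (auto simp: Pi_def)
    ultimately show ?case using add s insert by simp
  qed
qed

lemma (in abelian_monoid) finsum_swap:
  assumes "finite A" "finite B" "\<And>i j. \<lbrakk>i \<in> A; j \<in> B\<rbrakk> \<Longrightarrow> f i j \<in> carrier G"
  shows "(\<Oplus>i\<in>A. \<Oplus>j\<in>B. f i j) = (\<Oplus>j\<in>B. \<Oplus>i\<in>A. f i j)"
  using assms(1,3)
proof (induction A)
  case empty
  then show ?case by (simp add: finsum_zero)
next
  case (insert k A)
  have "(\<Oplus>i\<in>insert k A. \<Oplus>j\<in>B. f i j) = (\<Oplus>j\<in>B. f k j) \<oplus> (\<Oplus>i\<in>A. \<Oplus>j\<in>B. f i j)"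
    using insert by (intro finsum_insert) (auto simp: Pi_def)
  also have "\<dots> = (\<Oplus>j\<in>B. f k j) \<oplus> (\<Oplus>j\<in>B. \<Oplus>i\<in>A. f i j)"
    using insert by simp
  also have "\<dots> = (\<Oplus>j\<in>B. f k j \<oplus> (\<Oplus>i\<in>A. f i j))"
    using insert by (intro finsum_addf[symmetric]) (auto simp: Pi_def)
  also have "\<dots> = (\<Oplus>j\<in>B. \<Oplus>i\<in>insert k A. f i j)"
  proof (rule finsum_cong', goal_cases)
    case (3 j)
    then show ?case using insert by (intro finsum_insert[symmetric]) (auto simp: Pi_def)
  qed (use insert in \<open>auto simp: Pi_def\<close>)
  finally show ?case .
qed

text \<open>Evaluates an entry of a product with the identity matrix.\<close>

lemma (in abelian_monoid) finsum_eq_single: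
  assumes "finite A" "i \<in> A" "f i \<in> carrier G" "\<And>k. \<lbrakk>k \<in> A; k \<noteq> i\<rbrakk> \<Longrightarrow> f k = \<zero>"
  shows "finsum G f A = f i"
proof -
  have "finsum G f A = (\<Oplus>k\<in>A. if i = k then f i else \<zero>)"
    using assms by (intro finsum_cong') auto
  then show ?thesis using finsum_singleton[of i A "\<lambda>_. f i"] assms by simp
qed

section \<open>Biadditivity of the tensor product\<close>

locale tensor_factors = M: bimodule R S M + N: bimodule S T N
  for R :: "('r, 'a) ring_scheme" and S :: "('s, 'b) ring_scheme" and T :: "('t, 'c) ring_scheme"
    and M :: "('r, 's, 'm, 'd) bimodule_scheme" and N :: "('s, 't, 'n, 'e) bimodule_scheme"
begin

abbreviation "F \<equiv> free_Abelian_group (carrier M \<times> carrier N)"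
abbreviation "K \<equiv> tensor_kernel S M N"

lemma tensor_relations_in_carrier: "tensor_relations S M N \<subseteq> carrier F"
proof -
  interpret F: group F by simp
  have diff: "a - b \<in> carrier F" if "a \<in> carrier F" "b \<in> carrier F" for a b
    using that keys_diff[of a b] by (auto simp: carrier_free_Abelian_group_iff)
  show ?thesis
    unfolding tensor_relations_def
    by (auto intro!: diff simp: M.rsmult_closed N.lsmult_closed simp del: carrier_free_Abelian_group_iff)
qed

lemma tensor_kernel_normal: "K \<lhd> F"
  using comm_group.subgroup_imp_normal[OF abelian_free_Abelian_group]
    group.generate_is_subgroup[OF group_free_Abelian_group tensor_relations_in_carrier]
  by (simp add: tensor_kernel_def)

lemma tensor_closed:
  assumes "x \<in> carrier M" "y \<in> carrier N"
  shows "tensor S M N x y \<in> carrier (tensor_product S M N)"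
proof -
  interpret K: normal K F by (rule tensor_kernel_normal)
  show ?thesis
    using assms K.rcosetsI[OF K.subset, of "frag_of (x, y)"]
    by (simp add: tensor_def tensor_product_def Let_def FactGroup_def)
qed

text \<open>Addition of the tensor product is multiplication of cosets. So an equation between a
  tensor and a sum of two tensors holds as soon as the corresponding combination of
  generators is one of the relations.\<close>

lemma tensor_addI:
  assumes "frag_of (x, y) - frag_of (x', y') - frag_of (x'', y'') \<in> tensor_relations S M N"
    and "x \<in> carrier M" "x' \<in> carrier M" "x'' \<in> carrier M"
    and "y \<in> carrier N" "y' \<in> carrier N" "y'' \<in> carrier N"
  shows "tensor S M N x y
    = tensor S M N x' y' \<oplus>\<^bsub>tensor_product S M N\<^esub> tensor S M N x'' y''"
proof -
  interpret K: normal K F by (rule tensor_kernel_normal)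
  have c: "frag_of (x, y) \<in> carrier F" "frag_of (x', y') \<in> carrier F"
    "frag_of (x'', y'') \<in> carrier F"
    using assms by auto
  then have s: "frag_of (x', y') + frag_of (x'', y'') \<in> carrier F"
    using K.m_closed[OF c(2,3)] by simp
  have "frag_of (x, y) - frag_of (x', y') - frag_of (x'', y'') \<in> K"
    unfolding tensor_kernel_def by (rule generate.incl) fact
  then have "frag_of (x, y) \<in> K #>\<^bsub>F\<^esub> (frag_of (x', y') + frag_of (x'', y''))"
    unfolding r_coset_def by force
  then have "K #>\<^bsub>F\<^esub> frag_of (x, y) = K #>\<^bsub>F\<^esub> (frag_of (x', y') + frag_of (x'', y''))"
    using K.repr_independence[OF _ s K.subgroup_axioms] by simp
  also have "\<dots> = (K #>\<^bsub>F\<^esub> frag_of (x', y')) <#>\<^bsub>F\<^esub> (K #>\<^bsub>F\<^esub> frag_of (x'', y''))"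
    using K.rcos_sum[OF c(2,3)] by simp
  finally show ?thesis
    by (simp add: tensor_def tensor_product_def Let_def FactGroup_def)
qed

lemma tensor_add_left:
  assumes "x \<in> carrier M" "x' \<in> carrier M" "y \<in> carrier N"
  shows "tensor S M N (x \<oplus>\<^bsub>M\<^esub> x') y
    = tensor S M N x y \<oplus>\<^bsub>tensor_product S M N\<^esub> tensor S M N x' y"
  using assms by (intro tensor_addI) (auto simp: tensor_relations_def)

lemma tensor_add_right:
  assumes "x \<in> carrier M" "y \<in> carrier N" "y' \<in> carrier N"
  shows "tensor S M N x (y \<oplus>\<^bsub>N\<^esub> y')
    = tensor S M N x y \<oplus>\<^bsub>tensor_product S M N\<^esub> tensor S M N x y'"
  using assms by (intro tensor_addI) (auto simp: tensor_relations_def)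

end

section \<open>The ring structure on generalized matrices\<close>

context generalized_matrix_ring
begin

abbreviation "\<I> \<equiv> {1..n}"
abbreviation "mul \<equiv> gm_prod M \<theta>"
abbreviation "\<R> \<equiv> gm_ring n M \<theta>"

lemma abelian_group_entry: "\<lbrakk>i \<in> \<I>; j \<in> \<I>\<rbrakk> \<Longrightarrow> abelian_group (M i j)"
  using bimodule_entry bimodule.axioms(3) by blast

lemma tensor_factors_entry:
  "\<lbrakk>i \<in> \<I>; j \<in> \<I>; k \<in> \<I>\<rbrakk> \<Longrightarrow> tensor_factors (M i i) (M j j) (M k k) (M i j) (M j k)"
  using bimodule_entry by (intro tensor_factors.intro) auto

lemma theta_additive:
  assumes "i \<in> \<I>" "j \<in> \<I>" "k \<in> \<I>"
  shows "\<theta> i j k \<in> hom (add_monoid (tensor_product (M j j) (M i j) (M j k))) (add_monoid (M i k))"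
  using theta_hom[OF assms] by (simp add: bimodule_hom_def)

lemma mul_closed:
  assumes "i \<in> \<I>" "j \<in> \<I>" "k \<in> \<I>" "x \<in> carrier (M i j)" "y \<in> carrier (M j k)"
  shows "mul i j k x y \<in> carrier (M i k)"
  using hom_in_carrier[OF theta_additive[OF assms(1-3)]]
    tensor_factors.tensor_closed[OF tensor_factors_entry[OF assms(1-3)] assms(4,5)]
  by (simp add: gm_prod_def)

lemma mul_add_left:
  assumes "i \<in> \<I>" "j \<in> \<I>" "k \<in> \<I>"
    "x \<in> carrier (M i j)" "x' \<in> carrier (M i j)" "y \<in> carrier (M j k)"
  shows "mul i j k (x \<oplus>\<^bsub>M i j\<^esub> x') y = mul i j k x y \<oplus>\<^bsub>M i k\<^esub> mul i j k x' y"
proof -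
  interpret tensor_factors "M i i" "M j j" "M k k" "M i j" "M j k"
    using tensor_factors_entry assms by blast
  show ?thesis
    using assms hom_mult[OF theta_additive[OF assms(1-3)]]
    by (simp add: gm_prod_def tensor_add_left tensor_closed)
qed

lemma mul_add_right:
  assumes "i \<in> \<I>" "j \<in> \<I>" "k \<in> \<I>"
    "x \<in> carrier (M i j)" "y \<in> carrier (M j k)" "y' \<in> carrier (M j k)"
  shows "mul i j k x (y \<oplus>\<^bsub>M j k\<^esub> y') = mul i j k x y \<oplus>\<^bsub>M i k\<^esub> mul i j k x y'"
proof -
  interpret tensor_factors "M i i" "M j j" "M k k" "M i j" "M j k"
    using tensor_factors_entry assms by blast
  show ?thesis
    using assms hom_mult[OF theta_additive[OF assms(1-3)]]
    by (simp add: gm_prod_def tensor_add_right tensor_closed)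
qed

lemma group_hom_mul_left:
  assumes "i \<in> \<I>" "j \<in> \<I>" "k \<in> \<I>" "y \<in> carrier (M j k)"
  shows "group_hom (add_monoid (M i j)) (add_monoid (M i k)) (\<lambda>x. mul i j k x y)"
  using assms abelian_group.a_group[OF abelian_group_entry]
  by (auto simp: group_hom_def group_hom_axioms_def hom_def mul_closed mul_add_left)

lemma group_hom_mul_right:
  assumes "i \<in> \<I>" "j \<in> \<I>" "k \<in> \<I>" "x \<in> carrier (M i j)"
  shows "group_hom (add_monoid (M j k)) (add_monoid (M i k)) (mul i j k x)"
  using assms abelian_group.a_group[OF abelian_group_entry]
  by (auto simp: group_hom_def group_hom_axioms_def hom_def mul_closed mul_add_right)

lemma mul_zero_left:
  assumes "i \<in> \<I>" "j \<in> \<I>" "k \<in> \<I>" "y \<in> carrier (M j k)"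
  shows "mul i j k \<zero>\<^bsub>M i j\<^esub> y = \<zero>\<^bsub>M i k\<^esub>"
  using group_hom.hom_one[OF group_hom_mul_left[OF assms]] by simp

lemma mul_zero_right:
  assumes "i \<in> \<I>" "j \<in> \<I>" "k \<in> \<I>" "x \<in> carrier (M i j)"
  shows "mul i j k x \<zero>\<^bsub>M j k\<^esub> = \<zero>\<^bsub>M i k\<^esub>"
  using group_hom.hom_one[OF group_hom_mul_right[OF assms]] by simp

lemma mul_finsum_left:
  assumes ij: "i \<in> \<I>" "j \<in> \<I>" "k \<in> \<I>" and "y \<in> carrier (M j k)"
    and "finite A" "\<And>l. l \<in> A \<Longrightarrow> f l \<in> carrier (M i j)"
  shows "mul i j k (finsum (M i j) f A) y = finsum (M i k) (\<lambda>l. mul i j k (f l) y) A"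
  using assms group.subgroup_self[OF abelian_group.a_group[OF abelian_group_entry[OF ij(1,2)]]]
  by (intro finsum_additive[where H = "carrier (M i j)" and \<phi> = "\<lambda>x. mul i j k x y"]
      abelian_group_entry) (auto simp: mul_closed mul_add_left)

lemma mul_finsum_right:
  assumes ij: "i \<in> \<I>" "j \<in> \<I>" "k \<in> \<I>" and "x \<in> carrier (M i j)"
    and "finite A" "\<And>l. l \<in> A \<Longrightarrow> f l \<in> carrier (M j k)"
  shows "mul i j k x (finsum (M j k) f A) = finsum (M i k) (\<lambda>l. mul i j k x (f l)) A"
  using assms group.subgroup_self[OF abelian_group.a_group[OF abelian_group_entry[OF ij(2,3)]]]
  by (intro finsum_additive[where H = "carrier (M j k)" and \<phi> = "mul i j k x"]
      abelian_group_entry) (auto simp: mul_closed mul_add_right)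

lemma mul_one_left:
  assumes "i \<in> \<I>" "j \<in> \<I>" "x \<in> carrier (M i j)"
  shows "mul i i j \<one>\<^bsub>M i i\<^esub> x = x"
proof -
  interpret bimodule "M i i" "M j j" "M i j" using assms bimodule_entry by blast
  show ?thesis using assms theta_left[of i j "\<one>\<^bsub>M i i\<^esub>" x] by (simp add: lsmult_one)
qed

lemma mul_one_right:
  assumes "i \<in> \<I>" "j \<in> \<I>" "x \<in> carrier (M i j)"
  shows "mul i j j x \<one>\<^bsub>M j j\<^esub> = x"
proof -
  interpret bimodule "M i i" "M j j" "M i j" using assms bimodule_entry by blast
  show ?thesis using assms theta_right[of i j x "\<one>\<^bsub>M j j\<^esub>"] by (simp add: rsmult_one)
qed

lemma gm_carrier: "carrier \<R> = (\<Pi>\<^sub>E (i, j)\<in>\<I> \<times> \<I>. carrier (M i j))"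
  by (simp add: gm_ring_def)

lemma gm_entry_closed:
  "\<lbrakk>a \<in> carrier \<R>; i \<in> \<I>; j \<in> \<I>\<rbrakk> \<Longrightarrow> a (i, j) \<in> carrier (M i j)"
  by (auto simp: gm_carrier PiE_iff)

lemma gm_mult_entry:
  "\<lbrakk>i \<in> \<I>; j \<in> \<I>\<rbrakk> \<Longrightarrow>
    (a \<otimes>\<^bsub>\<R>\<^esub> b) (i, j) = (\<Oplus>\<^bsub>M i j\<^esub>k\<in>\<I>. mul i k j (a (i, k)) (b (k, j)))"
  by (simp add: gm_ring_def)

lemma gm_add_entry:
  "\<lbrakk>i \<in> \<I>; j \<in> \<I>\<rbrakk> \<Longrightarrow> (a \<oplus>\<^bsub>\<R>\<^esub> b) (i, j) = a (i, j) \<oplus>\<^bsub>M i j\<^esub> b (i, j)"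
  by (simp add: gm_ring_def)

lemma gm_zero_entry: "\<lbrakk>i \<in> \<I>; j \<in> \<I>\<rbrakk> \<Longrightarrow> \<zero>\<^bsub>\<R>\<^esub> (i, j) = \<zero>\<^bsub>M i j\<^esub>"
  by (simp add: gm_ring_def)

lemma gm_one_entry:
  "\<lbrakk>i \<in> \<I>; j \<in> \<I>\<rbrakk> \<Longrightarrow> \<one>\<^bsub>\<R>\<^esub> (i, j) = (if i = j then \<one>\<^bsub>M i j\<^esub> else \<zero>\<^bsub>M i j\<^esub>)"
  by (simp add: gm_ring_def)

lemmas gm_entry = gm_mult_entry gm_add_entry gm_zero_entry gm_one_entry

lemma matrix_eqI:
  assumes "a \<in> extensional (\<I> \<times> \<I>)" "b \<in> extensional (\<I> \<times> \<I>)"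
    and "\<And>i j. \<lbrakk>i \<in> \<I>; j \<in> \<I>\<rbrakk> \<Longrightarrow> a (i, j) = b (i, j)"
  shows "a = b"
  using assms by (intro extensionalityI[where A = "\<I> \<times> \<I>"]) auto

lemma gm_carrier_extensional: "a \<in> carrier \<R> \<Longrightarrow> a \<in> extensional (\<I> \<times> \<I>)"
  by (auto simp: gm_carrier PiE_iff)

lemma gm_extensional:
  "a \<oplus>\<^bsub>\<R>\<^esub> b \<in> extensional (\<I> \<times> \<I>)" "a \<otimes>\<^bsub>\<R>\<^esub> b \<in> extensional (\<I> \<times> \<I>)"
  "\<zero>\<^bsub>\<R>\<^esub> \<in> extensional (\<I> \<times> \<I>)" "\<one>\<^bsub>\<R>\<^esub> \<in> extensional (\<I> \<times> \<I>)"
  by (auto simp: gm_ring_def)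

lemma gm_carrierI:
  assumes "a \<in> extensional (\<I> \<times> \<I>)"
    and "\<And>i j. \<lbrakk>i \<in> \<I>; j \<in> \<I>\<rbrakk> \<Longrightarrow> a (i, j) \<in> carrier (M i j)"
  shows "a \<in> carrier \<R>"
  using assms by (auto simp: gm_carrier PiE_iff)

lemma gm_add_closed:
  assumes "a \<in> carrier \<R>" "b \<in> carrier \<R>"
  shows "a \<oplus>\<^bsub>\<R>\<^esub> b \<in> carrier \<R>"
  using assms[THEN gm_entry_closed] abelian_groupE(1)[OF abelian_group_entry]
  by (intro gm_carrierI gm_extensional) (simp add: gm_entry del: atLeastAtMost_iff)

lemma gm_mult_closed:
  assumes "a \<in> carrier \<R>" "b \<in> carrier \<R>"
  shows "a \<otimes>\<^bsub>\<R>\<^esub> b \<in> carrier \<R>"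
proof (intro gm_carrierI gm_extensional)
  fix i j assume ij: "i \<in> \<I>" "j \<in> \<I>"
  interpret abelian_group "M i j" using ij abelian_group_entry by blast
  show "(a \<otimes>\<^bsub>\<R>\<^esub> b) (i, j) \<in> carrier (M i j)"
    using ij assms[THEN gm_entry_closed]
    by (auto simp: gm_entry mul_closed simp del: atLeastAtMost_iff intro!: finsum_closed)
qed

lemma gm_abelian_group: "abelian_group \<R>"
proof (rule abelian_groupI)
  fix a b c assume a: "a \<in> carrier \<R>" and b: "b \<in> carrier \<R>" and c: "c \<in> carrier \<R>"
  note E = abelian_groupE[OF abelian_group_entry]
    gm_entry_closed[OF a] gm_entry_closed[OF b] gm_entry_closed[OF c]
  show "a \<oplus>\<^bsub>\<R>\<^esub> b \<in> carrier \<R>" using a b by (rule gm_add_closed)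
  show "(a \<oplus>\<^bsub>\<R>\<^esub> b) \<oplus>\<^bsub>\<R>\<^esub> c = a \<oplus>\<^bsub>\<R>\<^esub> (b \<oplus>\<^bsub>\<R>\<^esub> c)"
    by (intro matrix_eqI gm_extensional) (simp add: gm_entry E(3,7-) del: atLeastAtMost_iff)
  show "a \<oplus>\<^bsub>\<R>\<^esub> b = b \<oplus>\<^bsub>\<R>\<^esub> a"
    by (intro matrix_eqI gm_extensional) (simp add: gm_entry E(4)[OF _ _ E(7,8)] del: atLeastAtMost_iff)
  show "\<zero>\<^bsub>\<R>\<^esub> \<oplus>\<^bsub>\<R>\<^esub> a = a"
    by (intro matrix_eqI gm_extensional gm_carrier_extensional[OF a]) (simp add: gm_entry E(5,7-) del: atLeastAtMost_iff)
  let ?b = "\<lambda>(i, j)\<in>\<I> \<times> \<I>. \<ominus>\<^bsub>M i j\<^esub> a (i, j)"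
  have "?b \<in> carrier \<R>"
    using abelian_group.a_inv_closed[OF abelian_group_entry] E
    by (intro gm_carrierI) (simp_all del: atLeastAtMost_iff)
  moreover have "?b \<oplus>\<^bsub>\<R>\<^esub> a = \<zero>\<^bsub>\<R>\<^esub>"
    using abelian_group.l_neg[OF abelian_group_entry] E
    by (intro matrix_eqI gm_extensional) (simp_all add: gm_entry del: atLeastAtMost_iff)
  ultimately show "\<exists>b\<in>carrier \<R>. b \<oplus>\<^bsub>\<R>\<^esub> a = \<zero>\<^bsub>\<R>\<^esub>" by blast
next
  show "\<zero>\<^bsub>\<R>\<^esub> \<in> carrier \<R>"
    using abelian_groupE(2)[OF abelian_group_entry]
    by (intro gm_carrierI gm_extensional) (simp add: gm_entry del: atLeastAtMost_iff)
qed

text \<open>Both sides expand to the double sum of \<open>a\<^sub>i\<^sub>l (b\<^sub>l\<^sub>k c\<^sub>k\<^sub>j)\<close>, in the two orders of summation.\<close>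

lemma gm_mult_assoc:
  assumes a: "a \<in> carrier \<R>" and b: "b \<in> carrier \<R>" and c: "c \<in> carrier \<R>"
  shows "(a \<otimes>\<^bsub>\<R>\<^esub> b) \<otimes>\<^bsub>\<R>\<^esub> c = a \<otimes>\<^bsub>\<R>\<^esub> (b \<otimes>\<^bsub>\<R>\<^esub> c)"
proof (intro matrix_eqI gm_extensional)
  fix i j assume ij: "i \<in> \<I>" "j \<in> \<I>"
  interpret abelian_group "M i j" using ij abelian_group_entry by blast
  have A: "a (i, l) \<in> carrier (M i l)" if "l \<in> \<I>" for l
    using that a ij gm_entry_closed by blast
  have B: "b (l, k) \<in> carrier (M l k)" if "l \<in> \<I>" "k \<in> \<I>" for l k
    using that b gm_entry_closed by blast
  have C: "c (k, j) \<in> carrier (M k j)" if "k \<in> \<I>" for k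
    using that c ij gm_entry_closed by blast
  let ?t = "\<lambda>k l. mul i l j (a (i, l)) (mul l k j (b (l, k)) (c (k, j)))"
  have t: "?t k l \<in> carrier (M i j)" if "k \<in> \<I>" "l \<in> \<I>" for k l
    using that ij A B C by (simp add: mul_closed del: atLeastAtMost_iff)
  have l: "mul i k j (\<Oplus>\<^bsub>M i k\<^esub>l\<in>\<I>. mul i l k (a (i, l)) (b (l, k))) (c (k, j))
      = (\<Oplus>\<^bsub>M i j\<^esub>l\<in>\<I>. ?t k l)" if k: "k \<in> \<I>" for k
  proof -
    have "mul i k j (\<Oplus>\<^bsub>M i k\<^esub>l\<in>\<I>. mul i l k (a (i, l)) (b (l, k))) (c (k, j))
      = (\<Oplus>\<^bsub>M i j\<^esub>l\<in>\<I>. mul i k j (mul i l k (a (i, l)) (b (l, k))) (c (k, j)))"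
      using ij k A B C by (intro mul_finsum_left) (simp_all add: mul_closed del: atLeastAtMost_iff)
    also have "\<dots> = (\<Oplus>\<^bsub>M i j\<^esub>l\<in>\<I>. ?t k l)"
      using ij k A B C t
      by (intro finsum_cong') (auto simp: theta_assoc simp del: atLeastAtMost_iff)
    finally show ?thesis .
  qed
  have r: "mul i l j (a (i, l)) (\<Oplus>\<^bsub>M l j\<^esub>k\<in>\<I>. mul l k j (b (l, k)) (c (k, j)))
      = (\<Oplus>\<^bsub>M i j\<^esub>k\<in>\<I>. ?t k l)" if "l \<in> \<I>" for l
    using ij that A B C by (intro mul_finsum_right) (simp_all add: mul_closed del: atLeastAtMost_iff)
  have "((a \<otimes>\<^bsub>\<R>\<^esub> b) \<otimes>\<^bsub>\<R>\<^esub> c) (i, j) = (\<Oplus>\<^bsub>M i j\<^esub>k\<in>\<I>. \<Oplus>\<^bsub>M i j\<^esub>l\<in>\<I>. ?t k l)"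
    unfolding gm_mult_entry[OF ij]
    by (rule finsum_cong')
      (use ij t l in \<open>auto simp: gm_mult_entry simp del: atLeastAtMost_iff intro!: finsum_closed\<close>)
  also have "\<dots> = (\<Oplus>\<^bsub>M i j\<^esub>l\<in>\<I>. \<Oplus>\<^bsub>M i j\<^esub>k\<in>\<I>. ?t k l)"
    using t by (intro finsum_swap) auto
  also have "\<dots> = (a \<otimes>\<^bsub>\<R>\<^esub> (b \<otimes>\<^bsub>\<R>\<^esub> c)) (i, j)"
    unfolding gm_mult_entry[OF ij]
    by (rule finsum_cong')
      (use ij t r in \<open>auto simp: gm_mult_entry mul_closed gm_entry_closed[OF a]
        gm_entry_closed[OF gm_mult_closed[OF b c], unfolded gm_mult_entry]
        simp del: atLeastAtMost_iff intro!: finsum_closed\<close>)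
  finally show "((a \<otimes>\<^bsub>\<R>\<^esub> b) \<otimes>\<^bsub>\<R>\<^esub> c) (i, j) = (a \<otimes>\<^bsub>\<R>\<^esub> (b \<otimes>\<^bsub>\<R>\<^esub> c)) (i, j)" .
qed

lemma gm_one_closed: "\<one>\<^bsub>\<R>\<^esub> \<in> carrier \<R>"
  using abelian_groupE(2)[OF abelian_group_entry] ring.ring_simprules(6)[OF ring_diag]
  by (intro gm_carrierI gm_extensional) (simp add: gm_entry del: atLeastAtMost_iff)

lemma gm_monoid: "monoid \<R>"
proof (rule monoidI)
  fix a assume a: "a \<in> carrier \<R>"
  have A: "a (i, j) \<in> carrier (M i j)" if "i \<in> \<I>" "j \<in> \<I>" for i j
    using that a gm_entry_closed by blast
  show "\<one>\<^bsub>\<R>\<^esub> \<otimes>\<^bsub>\<R>\<^esub> a = a"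
  proof (intro matrix_eqI gm_extensional(2) gm_carrier_extensional[OF a])
    fix i j assume ij: "i \<in> \<I>" "j \<in> \<I>"
    interpret abelian_group "M i j" using ij abelian_group_entry by blast
    show "(\<one>\<^bsub>\<R>\<^esub> \<otimes>\<^bsub>\<R>\<^esub> a) (i, j) = a (i, j)"
      using ij A finsum_eq_single[of \<I> i "\<lambda>k. mul i k j (\<one>\<^bsub>\<R>\<^esub> (i, k)) (a (k, j))"]
      by (simp add: gm_mult_entry gm_one_entry mul_one_left mul_zero_left del: atLeastAtMost_iff)
  qed
  show "a \<otimes>\<^bsub>\<R>\<^esub> \<one>\<^bsub>\<R>\<^esub> = a"
  proof (intro matrix_eqI gm_extensional(2) gm_carrier_extensional[OF a])
    fix i j assume ij: "i \<in> \<I>" "j \<in> \<I>"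
    interpret abelian_group "M i j" using ij abelian_group_entry by blast
    show "(a \<otimes>\<^bsub>\<R>\<^esub> \<one>\<^bsub>\<R>\<^esub>) (i, j) = a (i, j)"
      using ij A finsum_eq_single[of \<I> j "\<lambda>k. mul i k j (a (i, k)) (\<one>\<^bsub>\<R>\<^esub> (k, j))"]
      by (simp add: gm_mult_entry gm_one_entry mul_one_right mul_zero_right del: atLeastAtMost_iff)
  qed
qed (simp_all add: gm_mult_closed gm_one_closed gm_mult_assoc)

lemma gm_is_ring: "ring \<R>"
proof (rule ringI[OF gm_abelian_group gm_monoid])
  fix a b c assume a: "a \<in> carrier \<R>" and b: "b \<in> carrier \<R>" and c: "c \<in> carrier \<R>"
  note E = gm_entry_closed[OF a] gm_entry_closed[OF b] gm_entry_closed[OF c]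
  show "(a \<oplus>\<^bsub>\<R>\<^esub> b) \<otimes>\<^bsub>\<R>\<^esub> c = a \<otimes>\<^bsub>\<R>\<^esub> c \<oplus>\<^bsub>\<R>\<^esub> b \<otimes>\<^bsub>\<R>\<^esub> c"
  proof (intro matrix_eqI gm_extensional)
    fix i j assume ij: "i \<in> \<I>" "j \<in> \<I>"
    interpret abelian_group "M i j" using ij abelian_group_entry by blast
    have "((a \<oplus>\<^bsub>\<R>\<^esub> b) \<otimes>\<^bsub>\<R>\<^esub> c) (i, j)
        = (\<Oplus>\<^bsub>M i j\<^esub>k\<in>\<I>. mul i k j (a (i, k)) (c (k, j)) \<oplus>\<^bsub>M i j\<^esub> mul i k j (b (i, k)) (c (k, j)))"
      unfolding gm_mult_entry[OF ij]
      by (rule finsum_cong')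
        (use ij E in \<open>auto simp: gm_add_entry mul_add_left mul_closed simp del: atLeastAtMost_iff\<close>)
    also have "\<dots> = (a \<otimes>\<^bsub>\<R>\<^esub> c \<oplus>\<^bsub>\<R>\<^esub> b \<otimes>\<^bsub>\<R>\<^esub> c) (i, j)"
      unfolding gm_add_entry[OF ij] gm_mult_entry[OF ij]
      by (rule finsum_addf) (use ij E in \<open>auto simp: mul_closed simp del: atLeastAtMost_iff\<close>)
    finally show "((a \<oplus>\<^bsub>\<R>\<^esub> b) \<otimes>\<^bsub>\<R>\<^esub> c) (i, j) = (a \<otimes>\<^bsub>\<R>\<^esub> c \<oplus>\<^bsub>\<R>\<^esub> b \<otimes>\<^bsub>\<R>\<^esub> c) (i, j)" .
  qed
  show "c \<otimes>\<^bsub>\<R>\<^esub> (a \<oplus>\<^bsub>\<R>\<^esub> b) = c \<otimes>\<^bsub>\<R>\<^esub> a \<oplus>\<^bsub>\<R>\<^esub> c \<otimes>\<^bsub>\<R>\<^esub> b"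
  proof (intro matrix_eqI gm_extensional)
    fix i j assume ij: "i \<in> \<I>" "j \<in> \<I>"
    interpret abelian_group "M i j" using ij abelian_group_entry by blast
    have "(c \<otimes>\<^bsub>\<R>\<^esub> (a \<oplus>\<^bsub>\<R>\<^esub> b)) (i, j)
        = (\<Oplus>\<^bsub>M i j\<^esub>k\<in>\<I>. mul i k j (c (i, k)) (a (k, j)) \<oplus>\<^bsub>M i j\<^esub> mul i k j (c (i, k)) (b (k, j)))"
      unfolding gm_mult_entry[OF ij]
      by (rule finsum_cong')
        (use ij E in \<open>auto simp: gm_add_entry mul_add_right mul_closed simp del: atLeastAtMost_iff\<close>)
    also have "\<dots> = (c \<otimes>\<^bsub>\<R>\<^esub> a \<oplus>\<^bsub>\<R>\<^esub> c \<otimes>\<^bsub>\<R>\<^esub> b) (i, j)"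
      unfolding gm_add_entry[OF ij] gm_mult_entry[OF ij]
      by (rule finsum_addf) (use ij E in \<open>auto simp: mul_closed simp del: atLeastAtMost_iff\<close>)
    finally show "(c \<otimes>\<^bsub>\<R>\<^esub> (a \<oplus>\<^bsub>\<R>\<^esub> b)) (i, j) = (c \<otimes>\<^bsub>\<R>\<^esub> a \<oplus>\<^bsub>\<R>\<^esub> c \<otimes>\<^bsub>\<R>\<^esub> b) (i, j)" .
  qed
qed

end

section \<open>The entries of the ideals\<close>

context gm_datum
begin

abbreviation "E g i j \<equiv> lprod (M i j) (D i g)"

lemma D_subset: "\<lbrakk>g \<in> carrier G; i \<in> \<I>\<rbrakk> \<Longrightarrow> D i g \<subseteq> carrier (M i i)"
  using partial_action.ideal_D[OF partial_action_diag] additive_subgroup.a_subset ideal.axioms(1)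
  by metis

lemma lsmult_generators_closed:
  assumes "g \<in> carrier G" "i \<in> \<I>" "j \<in> \<I>"
  shows "{lsmult (M i j) r x | r x. r \<in> D i g \<and> x \<in> carrier (M i j)} \<subseteq> carrier (M i j)"
  using D_subset[OF assms(1,2)] bimodule.lsmult_closed[OF bimodule_entry[OF assms(2,3)]] by blast

lemma rsmult_generators_closed:
  assumes "g \<in> carrier G" "i \<in> \<I>" "j \<in> \<I>"
  shows "{rsmult (M i j) x s | x s. x \<in> carrier (M i j) \<and> s \<in> D j g} \<subseteq> carrier (M i j)"
  using D_subset[OF assms(1,3)] bimodule.rsmult_closed[OF bimodule_entry[OF assms(2,3)]] by blast

lemma E_subgroup:
  assumes "g \<in> carrier G" "i \<in> \<I>" "j \<in> \<I>"
  shows "subgroup (E g i j) (add_monoid (M i j))"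
  using abelian_group.a_group[OF abelian_group_entry[OF assms(2,3)]] lsmult_generators_closed[OF assms]
  unfolding lprod_def by (intro group.generate_is_subgroup) simp_all

lemma E_subset:
  "\<lbrakk>g \<in> carrier G; i \<in> \<I>; j \<in> \<I>; x \<in> E g i j\<rbrakk> \<Longrightarrow> x \<in> carrier (M i j)"
  using subgroup.subset[OF E_subgroup] by fastforce

text \<open>A right multiplication is additive, so it suffices to treat generators \<open>r m\<close> with
  \<open>r \<in> D\<^sup>(\<^sup>i\<^sup>)\<^sub>g\<close>, for which \<open>(r m) y = r (m y)\<close>.\<close>

lemma E_mul_right:
  assumes g: "g \<in> carrier G" and ij: "i \<in> \<I>" "k \<in> \<I>" "j \<in> \<I>"
    and x: "x \<in> E g i k" and y: "y \<in> carrier (M k j)"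
  shows "mul i k j x y \<in> E g i j"
proof -
  let ?S = "{lsmult (M i k) r m | r m. r \<in> D i g \<and> m \<in> carrier (M i k)}"
  interpret h: group_hom "add_monoid (M i k)" "add_monoid (M i j)" "\<lambda>x. mul i k j x y"
    using group_hom_mul_left ij y by blast
  have "(\<lambda>x. mul i k j x y) ` ?S \<subseteq> E g i j"
  proof clarify
    fix r m assume r: "r \<in> D i g" and m: "m \<in> carrier (M i k)"
    then have r': "r \<in> carrier (M i i)" using D_subset g ij by blast
    have "mul i k j (lsmult (M i k) r m) y = mul i k j (mul i i k r m) y"
      using theta_left[OF ij(1,2) r' m] by simp
    also have "\<dots> = mul i i j r (mul i k j m y)"
      using theta_assoc[OF ij(1,1,2,3) r' m y] .
    also have "\<dots> = lsmult (M i j) r (mul i k j m y)"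
      using theta_left[OF ij(1,3) r' mul_closed[OF ij m y]] .
    also have "\<dots> \<in> E g i j"
      unfolding lprod_def using r mul_closed[OF ij m y] by (intro generate.incl) blast
    finally show "mul i k j (lsmult (M i k) r m) y \<in> E g i j" .
  qed
  then have "generate (add_monoid (M i j)) ((\<lambda>x. mul i k j x y) ` ?S) \<subseteq> E g i j"
    by (rule h.H.generate_subgroup_incl[OF _ E_subgroup[OF g ij(1,3)]])
  moreover have "x \<in> generate (add_monoid (M i k)) ?S" using x by (simp add: lprod_def)
  ultimately show ?thesis
    using h.generate_img[of ?S] lsmult_generators_closed[OF g ij(1,2)] by auto
qed

text \<open>The defining generators \<open>r m\<close> of \<open>E g k j\<close> are of no use here, since \<open>x (r m)\<close> has the factor
  \<open>r \<in> D\<^sup>(\<^sup>k\<^sup>)\<^sub>g\<close> in the middle. The condition \<open>D\<^sup>(\<^sup>k\<^sup>)\<^sub>g M k j = M k j D\<^sup>(\<^sup>j\<^sup>)\<^sub>g\<close> supplies generators \<open>m s\<close>,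
  for which \<open>x (m s) = (x m) s\<close>.\<close>

lemma E_mul_left:
  assumes g: "g \<in> carrier G" and ij: "i \<in> \<I>" "k \<in> \<I>" "j \<in> \<I>"
    and x: "x \<in> carrier (M i k)" and y: "y \<in> E g k j"
  shows "mul i k j x y \<in> E g i j"
proof -
  let ?S = "{rsmult (M k j) m s | m s. m \<in> carrier (M k j) \<and> s \<in> D j g}"
  interpret h: group_hom "add_monoid (M k j)" "add_monoid (M i j)" "mul i k j x"
    using group_hom_mul_right ij x by blast
  have "mul i k j x ` ?S \<subseteq> E g i j"
  proof clarify
    fix m s assume m: "m \<in> carrier (M k j)" and s: "s \<in> D j g"
    then have s': "s \<in> carrier (M j j)" using D_subset g ij by blast
    have "mul i k j x (rsmult (M k j) m s) = mul i k j x (mul k j j m s)"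
      using theta_right[OF ij(2,3) m s'] by simp
    also have "\<dots> = mul i j j (mul i k j x m) s"
      using theta_assoc[OF ij(1,2,3,3) x m s'] by simp
    also have "\<dots> = rsmult (M i j) (mul i k j x m) s"
      using theta_right[OF ij(1,3) mul_closed[OF ij x m] s'] .
    also have "\<dots> \<in> rprod (M i j) (D j g)"
      unfolding rprod_def using s mul_closed[OF ij x m] by (intro generate.incl) blast
    finally show "mul i k j x (rsmult (M k j) m s) \<in> E g i j"
      using lprod_eq_rprod[OF g ij(1,3)] by simp
  qed
  then have "generate (add_monoid (M i j)) (mul i k j x ` ?S) \<subseteq> E g i j"
    by (rule h.H.generate_subgroup_incl[OF _ E_subgroup[OF g ij(1,3)]])
  moreover have "y \<in> generate (add_monoid (M k j)) ?S"
    using y lprod_eq_rprod[OF g ij(2,3)] by (simp add: rprod_def)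
  ultimately show ?thesis
    using h.generate_img[of ?S] rsmult_generators_closed[OF g ij(2,3)] by auto
qed

lemma E_one:
  assumes "i \<in> \<I>" "j \<in> \<I>"
  shows "E \<one> i j = carrier (M i j)"
proof
  show "E \<one> i j \<subseteq> carrier (M i j)" using E_subset[OF one_closed assms] by blast
  show "carrier (M i j) \<subseteq> E \<one> i j"
  proof
    fix x assume x: "x \<in> carrier (M i j)"
    interpret bimodule "M i i" "M j j" "M i j" using assms bimodule_entry by blast
    \<comment> \<open>Unitality is what makes \<open>R\<^sub>i M i j\<close> all of \<open>M i j\<close>.\<close>
    have "\<one>\<^bsub>M i i\<^esub> \<in> D i \<one>"
      using partial_action.D_one[OF partial_action_diag[OF assms(1)]] by simp
    then have "lsmult (M i j) \<one>\<^bsub>M i i\<^esub> x \<in> E \<one> i j"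
      unfolding lprod_def using x by (intro generate.incl) blast
    then show "x \<in> E \<one> i j" using x by (simp add: lsmult_one)
  qed
qed

lemma gamma_bij:
  "\<lbrakk>g \<in> carrier G; i \<in> \<I>; j \<in> \<I>\<rbrakk> \<Longrightarrow> bij_betw (\<gamma> g i j) (E (inv g) i j) (E g i j)"
  using gamma_iso[of g i j] by (simp add: iso_def)

lemma gamma_closed:
  "\<lbrakk>g \<in> carrier G; i \<in> \<I>; j \<in> \<I>; x \<in> E (inv g) i j\<rbrakk> \<Longrightarrow> \<gamma> g i j x \<in> E g i j"
  using gamma_bij bij_betwE by blast

lemma gamma_add:
  "\<lbrakk>g \<in> carrier G; i \<in> \<I>; j \<in> \<I>; x \<in> E (inv g) i j; y \<in> E (inv g) i j\<rbrakk>
    \<Longrightarrow> \<gamma> g i j (x \<oplus>\<^bsub>M i j\<^esub> y) = \<gamma> g i j x \<oplus>\<^bsub>M i j\<^esub> \<gamma> g i j y"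
  using gamma_iso[of g i j] by (simp add: iso_def hom_def)

text \<open>The composition law for \<open>g\<close> and \<open>g\<^sup>-\<^sup>1\<close> applies on the whole domain, because
  \<open>\<gamma> (inv g) i j\<close> takes its values exactly where \<open>\<gamma> g i j\<close> is defined. The condition on domains in a
  datum speaks of preimages under \<open>\<gamma> h\<close>, that in a partial action of images under \<open>\<gamma> (inv h)\<close>; this
  lemma identifies the two.\<close>

lemma gamma_cancel:
  assumes "g \<in> carrier G" "i \<in> \<I>" "j \<in> \<I>" "x \<in> E g i j"
  shows "\<gamma> (inv g) i j x \<in> E (inv g) i j" "\<gamma> g i j (\<gamma> (inv g) i j x) = x"
proof -
  show c: "\<gamma> (inv g) i j x \<in> E (inv g) i j" using assms gamma_closed[of "inv g" i j x] by simp
  have "\<gamma> g i j (\<gamma> (inv g) i j x) = \<gamma> \<one> i j x"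
    using assms c gamma_comp[of g "inv g" i j x] by simp
  then show "\<gamma> g i j (\<gamma> (inv g) i j x) = x"
    using assms E_subset gamma_one by simp
qed

section \<open>The partial action\<close>

lemma datum_idealI:
  assumes "a \<in> extensional (\<I> \<times> \<I>)"
    and "\<And>i j. \<lbrakk>i \<in> \<I>; j \<in> \<I>\<rbrakk> \<Longrightarrow> a (i, j) \<in> E g i j"
  shows "a \<in> datum_ideal n M D g"
  using assms by (auto simp: datum_ideal_def PiE_iff)

lemma datum_ideal_entry:
  "\<lbrakk>a \<in> datum_ideal n M D g; i \<in> \<I>; j \<in> \<I>\<rbrakk> \<Longrightarrow> a (i, j) \<in> E g i j"
  by (auto simp: datum_ideal_def PiE_iff)

lemma datum_ideal_extensional:
  "a \<in> datum_ideal n M D g \<Longrightarrow> a \<in> extensional (\<I> \<times> \<I>)"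
  by (auto simp: datum_ideal_def PiE_iff)

lemma datum_ideal_subset:
  assumes "g \<in> carrier G" "a \<in> datum_ideal n M D g"
  shows "a \<in> carrier \<R>"
  using datum_ideal_extensional[OF assms(2)] E_subset[OF assms(1)] datum_ideal_entry[OF assms(2)]
  by (intro gm_carrierI) blast+

lemma datum_ideal_is_ideal:
  assumes g: "g \<in> carrier G"
  shows "ideal (datum_ideal n M D g) \<R>"
proof (rule idealI[OF gm_is_ring])
  interpret R: ring \<R> by (rule gm_is_ring)
  note sub = E_subgroup[OF g]
  show "subgroup (datum_ideal n M D g) (add_monoid \<R>)"
  proof (rule R.add.subgroupI)
    show "datum_ideal n M D g \<subseteq> carrier \<R>" using datum_ideal_subset[OF g] by blast
    have "\<zero>\<^bsub>\<R>\<^esub> \<in> datum_ideal n M D g"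
      using subgroup.one_closed[OF sub]
      by (intro datum_idealI gm_extensional) (simp add: gm_entry del: atLeastAtMost_iff)
    then show "datum_ideal n M D g \<noteq> {}" by blast
  next
    fix a b assume a: "a \<in> datum_ideal n M D g" and b: "b \<in> datum_ideal n M D g"
    show "a \<oplus>\<^bsub>\<R>\<^esub> b \<in> datum_ideal n M D g"
      using subgroup.m_closed[OF sub] datum_ideal_entry[OF a] datum_ideal_entry[OF b]
      by (intro datum_idealI gm_extensional) (simp add: gm_entry del: atLeastAtMost_iff)
  next
    fix a assume a: "a \<in> datum_ideal n M D g"
    let ?b = "\<lambda>(i, j)\<in>\<I> \<times> \<I>. \<ominus>\<^bsub>M i j\<^esub> a (i, j)"
    have b: "?b \<in> datum_ideal n M D g"
      using subgroup.m_inv_closed[OF sub] datum_ideal_entry[OF a]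
      by (intro datum_idealI) (simp_all add: a_inv_def del: atLeastAtMost_iff)
    have "?b \<oplus>\<^bsub>\<R>\<^esub> a = \<zero>\<^bsub>\<R>\<^esub>"
      using abelian_group.l_neg[OF abelian_group_entry] gm_entry_closed[OF datum_ideal_subset[OF g a]]
      by (intro matrix_eqI gm_extensional) (simp_all add: gm_entry del: atLeastAtMost_iff)
    then have "\<ominus>\<^bsub>\<R>\<^esub> a = ?b"
      using R.minus_equality datum_ideal_subset[OF g] a b by blast
    then show "\<ominus>\<^bsub>\<R>\<^esub> a \<in> datum_ideal n M D g" using b by simp
  qed
next
  fix a x assume a: "a \<in> datum_ideal n M D g" and x: "x \<in> carrier \<R>"
  show "x \<otimes>\<^bsub>\<R>\<^esub> a \<in> datum_ideal n M D g"
  proof (intro datum_idealI gm_extensional)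
    fix i j assume ij: "i \<in> \<I>" "j \<in> \<I>"
    show "(x \<otimes>\<^bsub>\<R>\<^esub> a) (i, j) \<in> E g i j"
      unfolding gm_mult_entry[OF ij]
      by (rule abelian_group.finsum_in_subgroup[OF abelian_group_entry[OF ij] E_subgroup[OF g ij]])
        (use g ij E_mul_left gm_entry_closed[OF x] datum_ideal_entry[OF a]
          in \<open>simp_all del: atLeastAtMost_iff\<close>)
  qed
  show "a \<otimes>\<^bsub>\<R>\<^esub> x \<in> datum_ideal n M D g"
  proof (intro datum_idealI gm_extensional)
    fix i j assume ij: "i \<in> \<I>" "j \<in> \<I>"
    show "(a \<otimes>\<^bsub>\<R>\<^esub> x) (i, j) \<in> E g i j"
      unfolding gm_mult_entry[OF ij]
      by (rule abelian_group.finsum_in_subgroup[OF abelian_group_entry[OF ij] E_subgroup[OF g ij]])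
        (use g ij E_mul_right gm_entry_closed[OF x] datum_ideal_entry[OF a]
          in \<open>simp_all del: atLeastAtMost_iff\<close>)
  qed
qed

lemma datum_map_entry:
  "\<lbrakk>i \<in> \<I>; j \<in> \<I>\<rbrakk> \<Longrightarrow> datum_map n \<gamma> g a (i, j) = \<gamma> g i j (a (i, j))"
  by (simp add: datum_map_def)

lemma datum_map_extensional: "datum_map n \<gamma> g a \<in> extensional (\<I> \<times> \<I>)"
  by (simp add: datum_map_def)

lemma datum_map_closed:
  assumes "g \<in> carrier G" "a \<in> datum_ideal n M D (inv g)"
  shows "datum_map n \<gamma> g a \<in> datum_ideal n M D g"
  using assms gamma_closed datum_ideal_entry[OF assms(2)]
  by (intro datum_idealI datum_map_extensional) (simp add: datum_map_entry del: atLeastAtMost_iff)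

lemma datum_map_cancel:
  assumes "g \<in> carrier G" "a \<in> datum_ideal n M D g"
  shows "datum_map n \<gamma> g (datum_map n \<gamma> (inv g) a) = a"
  using assms gamma_cancel(2) datum_ideal_entry[OF assms(2)]
  by (intro matrix_eqI datum_map_extensional datum_ideal_extensional)
    (simp_all add: datum_map_entry del: atLeastAtMost_iff)

lemma datum_map_bij:
  assumes "g \<in> carrier G"
  shows "bij_betw (datum_map n \<gamma> g) (datum_ideal n M D (inv g)) (datum_ideal n M D g)"
  using assms datum_map_closed[of g] datum_map_closed[of "inv g"]
    datum_map_cancel[of g] datum_map_cancel[of "inv g"]
  by (intro bij_betw_byWitness[where f' = "datum_map n \<gamma> (inv g)"]) auto

lemma datum_map_add:
  assumes "g \<in> carrier G" "a \<in> datum_ideal n M D (inv g)" "b \<in> datum_ideal n M D (inv g)"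
  shows "datum_map n \<gamma> g (a \<oplus>\<^bsub>\<R>\<^esub> b) = datum_map n \<gamma> g a \<oplus>\<^bsub>\<R>\<^esub> datum_map n \<gamma> g b"
  using assms gamma_add datum_ideal_entry
  by (intro matrix_eqI datum_map_extensional gm_extensional)
    (simp add: datum_map_entry gm_add_entry del: atLeastAtMost_iff)

text \<open>Entrywise this is \<open>\<gamma>(\<Sum>\<^sub>k a\<^sub>i\<^sub>k b\<^sub>k\<^sub>j) = \<Sum>\<^sub>k \<gamma>(a\<^sub>i\<^sub>k b\<^sub>k\<^sub>j) = \<Sum>\<^sub>k \<gamma>(a\<^sub>i\<^sub>k) \<gamma>(b\<^sub>k\<^sub>j)\<close>. For the first step each
  summand must lie in the domain of \<open>\<gamma>\<close>, which is the ideal property of \<open>E_mul_left\<close>.\<close>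

lemma datum_map_mult:
  assumes g: "g \<in> carrier G"
    and a: "a \<in> datum_ideal n M D (inv g)" and b: "b \<in> datum_ideal n M D (inv g)"
  shows "datum_map n \<gamma> g (a \<otimes>\<^bsub>\<R>\<^esub> b) = datum_map n \<gamma> g a \<otimes>\<^bsub>\<R>\<^esub> datum_map n \<gamma> g b"
proof (intro matrix_eqI datum_map_extensional gm_extensional)
  fix i j assume ij: "i \<in> \<I>" "j \<in> \<I>"
  interpret abelian_group "M i j" using ij abelian_group_entry by blast
  have g': "inv g \<in> carrier G" using g by simp
  note A = datum_ideal_entry[OF a] and B = datum_ideal_entry[OF b]
  have ab: "mul i k j (a (i, k)) (b (k, j)) \<in> E (inv g) i j" if "k \<in> \<I>" for k
    using ij that g' A B E_subset[OF g'] by (intro E_mul_left) blast+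
  have c: "mul i k j (\<gamma> g i k (a (i, k))) (\<gamma> g k j (b (k, j))) \<in> carrier (M i j)"
    if "k \<in> \<I>" for k
    using ij that A B g by (intro mul_closed E_subset[OF g] gamma_closed) blast+
  have "datum_map n \<gamma> g (a \<otimes>\<^bsub>\<R>\<^esub> b) (i, j)
      = \<gamma> g i j (\<Oplus>\<^bsub>M i j\<^esub>k\<in>\<I>. mul i k j (a (i, k)) (b (k, j)))"
    using ij by (simp add: datum_map_entry gm_mult_entry del: atLeastAtMost_iff)
  also have "\<dots> = (\<Oplus>\<^bsub>M i j\<^esub>k\<in>\<I>. \<gamma> g i j (mul i k j (a (i, k)) (b (k, j))))"
    using ab gamma_add[OF g ij] gamma_closed[OF g ij] E_subset[OF g ij]
    by (intro finsum_additive[OF _ _ E_subgroup[OF g' ij]] abelian_group_axioms)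
      (simp_all del: atLeastAtMost_iff)
  also have "\<dots> = (\<Oplus>\<^bsub>M i j\<^esub>k\<in>\<I>. mul i k j (\<gamma> g i k (a (i, k))) (\<gamma> g k j (b (k, j))))"
  proof (rule finsum_cong')
    show "(\<lambda>k. mul i k j (\<gamma> g i k (a (i, k))) (\<gamma> g k j (b (k, j)))) \<in> \<I> \<rightarrow> carrier (M i j)"
      using c by blast
    show "\<gamma> g i j (mul i k j (a (i, k)) (b (k, j)))
        = mul i k j (\<gamma> g i k (a (i, k))) (\<gamma> g k j (b (k, j)))" if "k \<in> \<I>" for k
      using gamma_mult[OF g ij that A[OF ij(1) that] B[OF that ij(2)]] by simp
  qed simp
  also have "\<dots> = (datum_map n \<gamma> g a \<otimes>\<^bsub>\<R>\<^esub> datum_map n \<gamma> g b) (i, j)"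
    unfolding gm_mult_entry[OF ij]
    by (rule finsum_cong')
      (use ij c in \<open>auto simp: datum_map_entry simp del: atLeastAtMost_iff\<close>)
  finally show "datum_map n \<gamma> g (a \<otimes>\<^bsub>\<R>\<^esub> b) (i, j)
      = (datum_map n \<gamma> g a \<otimes>\<^bsub>\<R>\<^esub> datum_map n \<gamma> g b) (i, j)" .
qed

lemma partial_action_gm_ring:
  "partial_action G \<R> (datum_ideal n M D) (datum_map n \<gamma>)"
proof (intro partial_action.intro partial_action_axioms.intro)
  show "group G" by (rule group_axioms)
  show "ring \<R>" by (rule gm_is_ring)
next
  fix g assume "g \<in> carrier G"
  then show "ideal (datum_ideal n M D g) \<R>" by (rule datum_ideal_is_ideal)
next
  fix g assume g: "g \<in> carrier G"
  have "datum_map n \<gamma> g a \<in> datum_ideal n M D g" if "a \<in> datum_ideal n M D (inv g)" for a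
    using g that datum_map_closed by blast
  then show "datum_map n \<gamma> g \<in> rng_iso (\<R>\<lparr>carrier := datum_ideal n M D (inv g)\<rparr>)
      (\<R>\<lparr>carrier := datum_ideal n M D g\<rparr>)"
    using datum_map_bij[OF g] datum_map_add[OF g] datum_map_mult[OF g]
    by (simp add: rng_iso_def iso_def hom_def)
next
  show "datum_ideal n M D \<one> = carrier \<R>"
    unfolding datum_ideal_def gm_carrier by (rule PiE_cong) (auto simp: E_one)
next
  fix a assume a: "a \<in> carrier \<R>"
  then show "datum_map n \<gamma> \<one> a = a"
    using gamma_one gm_entry_closed[OF a]
    by (intro matrix_eqI datum_map_extensional gm_carrier_extensional)
      (simp_all add: datum_map_entry del: atLeastAtMost_iff)
next
  fix g h assume g: "g \<in> carrier G" and h: "h \<in> carrier G"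
  show "datum_map n \<gamma> (inv h) ` (datum_ideal n M D h \<inter> datum_ideal n M D (inv g))
      \<subseteq> datum_ideal n M D (inv (g \<otimes> h))"
  proof (clarify, intro datum_idealI datum_map_extensional)
    fix b i j
    assume b: "b \<in> datum_ideal n M D h" "b \<in> datum_ideal n M D (inv g)"
      and ij: "i \<in> \<I>" "j \<in> \<I>"
    have b_ij: "b (i, j) \<in> E h i j" "b (i, j) \<in> E (inv g) i j"
      using b ij datum_ideal_entry by blast+
    \<comment> \<open>The element \<open>a = \<gamma> (inv h) i j (b (i, j))\<close> satisfies \<open>\<gamma> h i j a = b (i, j)\<close>, so it is in the
      preimage to which the domain condition of the datum refers.\<close>
    show "datum_map n \<gamma> (inv h) b (i, j) \<in> E (inv (g \<otimes> h)) i j"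
      unfolding datum_map_entry[OF ij]
      using gamma_dom[OF g h ij] gamma_cancel[OF h ij b_ij(1)] b_ij by simp
  qed
  fix a assume a: "a \<in> datum_ideal n M D (inv h)"
    and ha: "datum_map n \<gamma> h a \<in> datum_ideal n M D h \<inter> datum_ideal n M D (inv g)"
  show "datum_map n \<gamma> g (datum_map n \<gamma> h a) = datum_map n \<gamma> (g \<otimes> h) a"
  proof (intro matrix_eqI datum_map_extensional)
    fix i j assume ij: "i \<in> \<I>" "j \<in> \<I>"
    have "\<gamma> h i j (a (i, j)) \<in> E (inv g) i j \<inter> E h i j"
      using ha datum_ideal_entry[of "datum_map n \<gamma> h a"] ij by (auto simp flip: datum_map_entry)
    then show "datum_map n \<gamma> g (datum_map n \<gamma> h a) (i, j) = datum_map n \<gamma> (g \<otimes> h) a (i, j)"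
      using gamma_comp[OF g h ij datum_ideal_entry[OF a ij]] ij by (simp add: datum_map_entry)
  qed
qed

end

theorem theorem4p3:
  fixes G :: "('g, 'm) monoid_scheme"
    and n :: nat
    and M :: "'a gm_entries"
    and \<theta> :: "'a gm_maps"
    and D :: "nat \<Rightarrow> 'g \<Rightarrow> 'a set"
    and \<alpha> :: "nat \<Rightarrow> 'g \<Rightarrow> 'a \<Rightarrow> 'a"
    and \<gamma> :: "'g \<Rightarrow> nat \<Rightarrow> nat \<Rightarrow> 'a \<Rightarrow> 'a"
  assumes "group G"
    and "n \<ge> 1"
    and "generalized_matrix_ring n M \<theta>"
    and "gm_datum G n M \<theta> D \<alpha> \<gamma>"
  shows "partial_action G (gm_ring n M \<theta>) (datum_ideal n M D) (datum_map n \<gamma>)"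
  using assms(4) by (rule gm_datum.partial_action_gm_ring)

end
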